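(* Let $\Omega = \bigcup_{i=1}^{n} (a_i, b_i) \subset \mathbb{R}$, where $a_1 < b_1 < a_2 < b_2 < \dots < a_n < b_n$, and assume that $\Omega$ weakly tiles its complement. Then for each $1 \le k \le n-1$ the gap length $a_{k+1} - b_k$ is representable in the form $\sum_{i=1}^{n} p_i (b_i - a_i)$ where $p_1, \dots, p_n$ are nonnegative integers (depending on $k$).
   Context: A bounded, measurable set $\Omega \subset \mathbb{R}$ weakly tiles its complement $\Omega^\complement = \mathbb{R} \setminus \Omega$ if there exists a positive, locally finite (Borel) measure $\nu$ on $\mathbb{R}$ such that $\mathbf{1}_\Omega * \nu = \mathbf{1}_{\Omega^\complement}$ almost everywhere with respect to Lebesgue measure. *)

theory Defs
  imports "HOL-Analysis.Analysis"
begin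

definition locally_finite_measure :: "'a::topological_space measure \<Rightarrow> bool" where
  "locally_finite_measure \<nu> \<longleftrightarrow> (\<forall>x. \<exists>U. open U \<and> x \<in> U \<and> emeasure \<nu> U < \<infinity>)"

text \<open>
  Convolution of a nonnegative function with a positive measure. The integrand need not be
  Borel measurable in \<open>y\<close> when \<open>f\<close> is only Lebesgue measurable; \<open>nn_integral\<close> then agrees
  with the integral over the completion of \<open>\<nu>\<close> wherever that integral is defined.
\<close>

definition conv_fun_measure :: "(real \<Rightarrow> ennreal) \<Rightarrow> real measure \<Rightarrow> real \<Rightarrow> ennreal" where
  "conv_fun_measure f \<nu> x = (\<integral>\<^sup>+ y. f (x - y) \<partial>\<nu>)"

definition weakly_tiles_complement :: "real set \<Rightarrow> bool" where
  "weakly_tiles_complement \<Omega> \<longleftrightarrow>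
     bounded \<Omega> \<and> \<Omega> \<in> sets lebesgue \<and>
     (\<exists>\<nu> :: real measure. sets \<nu> = sets borel \<and> locally_finite_measure \<nu> \<and>
        (AE x in lborel. conv_fun_measure (indicator \<Omega>) \<nu> x = indicator (- \<Omega>) x))"

end

theory Submission imports Defs begin

text \<open>
  The function \<open>conv_fun_measure (indicator \<Omega>) \<nu>\<close> can jump at \<open>y\<close> only through atoms of \<open>\<nu>\<close>: an
  atom at \<open>y - a i\<close> makes it jump up, an atom at \<open>y - b i\<close> makes it jump down. It equals \<open>1\<close> on the
  gap and \<open>0\<close> to the left of \<open>b k\<close>, so it jumps up at \<open>b k\<close> and does not jump inside the gap.
  Hence there is an atom \<open>t = b k - a i\<close>, and the translated interval \<open>{a i + t<..<b i + t}\<close>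
  starts at \<open>b k\<close>. It misses \<open>\<Omega>\<close>, so it ends inside the gap or at \<open>a (k + 1)\<close>. In the
  former case the jump down at its right endpoint has to be compensated by another atom, which gives
  a next interval starting there. All steps are bounded below, so the chain of intervals reaches
  \<open>a (k + 1)\<close> after finitely many steps.
\<close>

section \<open>Compact sets, almost-everywhere statements and one-sided limits\<close>

lemma locally_finite_measure_compact:
  assumes "locally_finite_measure \<nu>" "sets \<nu> = sets borel" "compact K"
  shows "emeasure \<nu> K < \<infinity>"
proof -
  obtain U where U: "\<And>x. open (U x)" "\<And>x. x \<in> U x" "\<And>x. emeasure \<nu> (U x) < \<infinity>"
    using assms(1) unfolding locally_finite_measure_def by metis
  obtain T where T: "finite T" "K \<subseteq> (\<Union>x\<in>T. U x)"
    using compactE_image[OF assms(3), of UNIV U] U(1,2) by (metis UN_I UNIV_I subsetI)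
  have m: "U x \<in> sets \<nu>" for x
    using U(1) assms(2) by simp
  have "emeasure \<nu> K \<le> emeasure \<nu> (\<Union>x\<in>T. U x)"
    using T(2) m T(1) by (intro emeasure_mono) auto
  also have "\<dots> \<le> (\<Sum>x\<in>T. emeasure \<nu> (U x))"
    using T(1) m by (intro emeasure_subadditive_finite) auto
  also have "\<dots> < \<infinity>"
    using U(3) T(1) by (simp add: less_top[symmetric])
  finally show ?thesis .
qed

lemma AE_lborel_open_ex:
  fixes S :: "'a::euclidean_space set"
  assumes "AE x in lborel. P x" "open S" "S \<noteq> {}"
  shows "\<exists>x\<in>S. P x"
proof (rule ccontr)
  assume "\<not> ?thesis"
  with assms(1) have "AE x in lborel. x \<notin> S"
    by (auto elim: AE_mp)
  with assms(2) have "S \<in> null_sets lborel"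
    by (subst AE_iff_null_sets) auto
  then have "negligible S"
    using null_sets_completionI negligible_iff_null_sets by blast
  with assms(2,3) show False
    using open_not_negligible by blast
qed

text \<open>The tiling equation may fail on a null set, so it cannot be evaluated at a chosen
  endpoint \<open>y\<close>. A null set contains no interval, hence good points exist arbitrarily
  close to \<open>y\<close> on either side.\<close>

lemma AE_lborel_seq_at_right:
  fixes y :: real
  assumes "AE x in lborel. P x"
  obtains X where "\<And>n::nat. P (X n)" "filterlim X (at_right y) sequentially"
proof -
  have "\<forall>n::nat. \<exists>x\<in>{y<..<y + 1 / real (Suc n)}. P x"
    by (intro allI AE_lborel_open_ex[OF assms]) (auto simp: less_add_same_cancel1)
  then obtain X where X: "\<And>n. X n \<in> {y<..<y + 1 / real (Suc n)}" "\<And>n. P (X n)"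
    by metis
  have "(\<lambda>n. y + 1 / real (Suc n)) \<longlonglongrightarrow> y + 0"
    by (intro tendsto_intros LIMSEQ_Suc[OF lim_1_over_n])
  then have "X \<longlonglongrightarrow> y"
    using X(1) by (intro tendsto_sandwich[of "\<lambda>_. y" X sequentially "\<lambda>n. y + 1 / real (Suc n)"])
      (auto intro!: always_eventually less_imp_le)
  moreover have "X n \<noteq> y" for n
    using X(1)[of n] by simp
  ultimately show ?thesis
    using X by (intro that[of X]) (auto simp: filterlim_at)
qed

lemma AE_lborel_seq_at_left:
  fixes y :: real
  assumes "AE x in lborel. P x"
  obtains X where "\<And>n::nat. P (X n)" "filterlim X (at_left y) sequentially"
proof -
  have "\<forall>n::nat. \<exists>x\<in>{y - 1 / real (Suc n)<..<y}. P x"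
    by (intro allI AE_lborel_open_ex[OF assms]) (auto simp: field_simps)
  then obtain X where X: "\<And>n. X n \<in> {y - 1 / real (Suc n)<..<y}" "\<And>n. P (X n)"
    by metis
  have "(\<lambda>n. y - 1 / real (Suc n)) \<longlonglongrightarrow> y - 0"
    by (intro tendsto_intros LIMSEQ_Suc[OF lim_1_over_n])
  then have "X \<longlonglongrightarrow> y"
    using X(1) by (intro tendsto_sandwich[of "\<lambda>n. y - 1 / real (Suc n)" X sequentially "\<lambda>_. y"])
      (auto intro!: always_eventually less_imp_le)
  moreover have "X n \<noteq> y" for n
    using X(1)[of n] by simp
  ultimately show ?thesis
    using X by (intro that[of X]) (auto simp: filterlim_at)
qed

lemma filterlim_diff_const_at_right:
  fixes y :: real
  assumes "filterlim X (at_right y) F"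
  shows "filterlim (\<lambda>n. X n - t) (at_right (y - t)) F"
  using assms by (auto simp: filterlim_at elim!: eventually_mono intro!: tendsto_intros)

lemma filterlim_diff_const_at_left:
  fixes y :: real
  assumes "filterlim X (at_left y) F"
  shows "filterlim (\<lambda>n. X n - t) (at_left (y - t)) F"
  using assms by (auto simp: filterlim_at elim!: eventually_mono intro!: tendsto_intros)

lemma filterlim_diff_const_open:
  fixes y :: real
  assumes "filterlim X (at y within A) F" "open S" "y - t \<in> S"
  shows "\<forall>\<^sub>F n in F. X n - t \<in> S"
proof -
  have "((\<lambda>n. X n - t) \<longlongrightarrow> y - t) F"
    using assms(1) by (auto simp: filterlim_at intro!: tendsto_intros)
  then show ?thesis
    using assms(2,3) by (rule topological_tendstoD)
qed

section \<open>One-sided limits of the convolution of an indicator with \<nu>\<close>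

lemma conv_indicator_ge_atom:
  assumes [simp]: "sets \<nu> = sets borel" and "open S" "x - t \<in> S"
  shows "emeasure \<nu> {t} \<le> conv_fun_measure (indicator S) \<nu> x"
proof -
  have "emeasure \<nu> {t} = (\<integral>\<^sup>+ s. indicator {t} s \<partial>\<nu>)"
    by simp
  also have "\<dots> \<le> conv_fun_measure (indicator S) \<nu> x"
    unfolding conv_fun_measure_def
    using assms(3) by (intro nn_integral_mono) (auto simp: indicator_def)
  finally show ?thesis .
qed

lemma measurable_translate_indicator [measurable]:
  fixes S :: "real set"
  assumes "sets \<nu> = sets borel" "open S"
  shows "(\<lambda>t. indicator S (x - t) :: ennreal) \<in> borel_measurable \<nu>"
proof -
  have "(\<lambda>t. indicator S (x - t) :: ennreal) \<in> borel_measurable borel"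
    using assms(2) by (intro measurable_compose[OF _ borel_measurable_indicator, of _ _ borel]) auto
  then show ?thesis
    using measurable_cong_sets[OF assms(1) refl] by blast
qed

text \<open>Fatou's lemma along good points approaching \<open>y\<close> from the left. Think of
  \<open>c\<close> as a right endpoint of \<open>S\<close>: an atom at \<open>y - c\<close> is
  eventually counted at these points but not at \<open>y\<close>. Whatever is counted at
  \<open>y\<close> is eventually counted there too, because \<open>S\<close> is open.\<close>

lemma conv_indicator_left_limit:
  assumes \<nu> [simp]: "sets \<nu> = sets borel" and S: "open S"
    and ae: "AE x in lborel. conv_fun_measure (indicator S) \<nu> x = g x"
    and l: "\<forall>\<^sub>F x in at_left y. g x = l"
    and c: "c \<notin> S" "\<forall>\<^sub>F s in at_left c. s \<in> S"
  shows "conv_fun_measure (indicator S) \<nu> y + emeasure \<nu> {y - c} \<le> l"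
proof -
  note [measurable] = measurable_translate_indicator[OF \<nu> S]
  obtain X where X: "\<And>n::nat. conv_fun_measure (indicator S) \<nu> (X n) = g (X n)"
      "filterlim X (at_left y) sequentially"
    using AE_lborel_seq_at_left[OF ae] by blast
  have "conv_fun_measure (indicator S) \<nu> y + emeasure \<nu> {y - c}
      = (\<integral>\<^sup>+ t. indicator S (y - t) + indicator {y - c} t \<partial>\<nu>)"
    unfolding conv_fun_measure_def
    by (subst nn_integral_add) (simp_all add: borel_measurable_indicator)
  also have "\<dots> \<le> (\<integral>\<^sup>+ t. liminf (\<lambda>n. indicator S (X n - t)) \<partial>\<nu>)"
  proof (rule nn_integral_mono)
    fix t
    have 1: "1 \<le> liminf (\<lambda>n. indicator S (X n - t) :: ennreal)"
      if "y - t \<in> S \<or> t = y - c"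
    proof -
      have "\<forall>\<^sub>F n in sequentially. X n - t \<in> S"
        using that
      proof
        assume "y - t \<in> S"
        with X(2) S show ?thesis
          by (rule filterlim_diff_const_open)
      next
        assume "t = y - c"
        then have "filterlim (\<lambda>n. X n - t) (at_left c) sequentially"
          using filterlim_diff_const_at_left[OF X(2), of t] by simp
        with c(2) show ?thesis
          by (rule eventually_compose_filterlim)
      qed
      then show ?thesis
        by (intro Liminf_bounded) (auto elim: eventually_mono)
    qed
    show "indicator S (y - t) + indicator {y - c} t \<le> liminf (\<lambda>n. indicator S (X n - t) :: ennreal)"
      using 1 c(1) by (auto simp: indicator_def)
  qed
  also have "\<dots> \<le> liminf (\<lambda>n. conv_fun_measure (indicator S) \<nu> (X n))"
    unfolding conv_fun_measure_def by (rule nn_integral_liminf) simp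
  also have "\<dots> = liminf (\<lambda>n. l)"
    unfolding X(1) using eventually_compose_filterlim[OF l X(2)] by (rule Liminf_eq)
  also have "\<dots> = l"
    by (simp add: Liminf_const)
  finally show ?thesis .
qed

text \<open>Dominated convergence along good points from the right. Openness of \<open>S\<close>
  gives pointwise convergence where \<open>y - t \<in> S\<close>. Elsewhere \<open>nc\<close> gives
  it, since for almost all \<open>t\<close> it excludes that \<open>y - t\<close> is a left endpoint
  of \<open>S\<close>.\<close>

lemma conv_indicator_right_limit:
  assumes \<nu> [simp]: "sets \<nu> = sets borel" and lf: "locally_finite_measure \<nu>"
    and S: "open S" "bounded S"
    and ae: "AE x in lborel. conv_fun_measure (indicator S) \<nu> x = g x"
    and l: "\<forall>\<^sub>F x in at_right y. g x = l"
    and nc: "AE t in \<nu>. y - t \<notin> S \<longrightarrow> (\<forall>\<^sub>F s in at_right (y - t). s \<notin> S)"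
  shows "conv_fun_measure (indicator S) \<nu> y = l"
proof -
  note [measurable] = measurable_translate_indicator[OF \<nu> S(1)]
  obtain X where X: "\<And>n::nat. conv_fun_measure (indicator S) \<nu> (X n) = g (X n)"
      "filterlim X (at_right y) sequentially"
    using AE_lborel_seq_at_right[OF ae] by blast
  have "X \<longlonglongrightarrow> y"
    using X(2) by (simp add: filterlim_at)
  then have "bounded (range X)"
    by (rule convergent_imp_bounded)
  \<comment> \<open>If \<open>X n - t \<in> S\<close> for any \<open>n\<close>, then
    \<open>t\<close> lies in the ball of radius \<open>r1 + r2\<close>. Its indicator is the
    dominating function, integrable by local finiteness.\<close>
  then obtain r1 r2 where r: "\<And>n. norm (X n) \<le> r1" "\<And>s. s \<in> S \<Longrightarrow> norm s \<le> r2"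
    using S(2) unfolding bounded_iff by blast
  have "(\<lambda>n. \<integral>\<^sup>+ t. indicator S (X n - t) \<partial>\<nu>) \<longlonglongrightarrow> (\<integral>\<^sup>+ t. indicator S (y - t) \<partial>\<nu>)"
  proof (rule nn_integral_dominated_convergence)
    show "(\<integral>\<^sup>+ t. indicator (cball 0 (r1 + r2)) t \<partial>\<nu>) < \<infinity>"
      using locally_finite_measure_compact[OF lf \<nu>, of "cball 0 (r1 + r2)"] by simp
    show "AE t in \<nu>. indicator S (X n - t) \<le> (indicator (cball 0 (r1 + r2)) t :: ennreal)" for n
    proof (rule AE_I2)
      show "indicator S (X n - t) \<le> (indicator (cball 0 (r1 + r2)) t :: ennreal)" for t
        using r(1)[of n] r(2)[of "X n - t"] by (auto simp: indicator_def)
    qed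
    show "AE t in \<nu>. (\<lambda>n. indicator S (X n - t) :: ennreal) \<longlonglongrightarrow> indicator S (y - t)"
      using nc
    proof eventually_elim
      case (elim t)
      have "\<forall>\<^sub>F n in sequentially. X n - t \<in> S \<longleftrightarrow> y - t \<in> S"
      proof (cases "y - t \<in> S")
        case True
        then show ?thesis
          using filterlim_diff_const_open[OF X(2) S(1) True] by simp
      next
        case False
        then show ?thesis
          using eventually_compose_filterlim[OF _ filterlim_diff_const_at_right[OF X(2)]] elim
          by simp
      qed
      then show ?case
        by (intro tendsto_eventually) (auto elim!: eventually_mono simp: indicator_def)
    qed
  qed (simp_all add: borel_measurable_indicator)
  then have "(\<lambda>n. g (X n)) \<longlonglongrightarrow> conv_fun_measure (indicator S) \<nu> y"
    unfolding conv_fun_measure_def[symmetric] X(1) .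
  moreover have "(\<lambda>n. g (X n)) \<longlonglongrightarrow> l"
    using eventually_compose_filterlim[OF l X(2)] by (rule tendsto_eventually)
  ultimately show ?thesis
    by (rule LIMSEQ_unique)
qed

section \<open>Atoms of a weak tiling and the walk across a gap\<close>

lemma weak_tiling_atom_disjoint:
  assumes \<nu>: "sets \<nu> = sets borel" and S: "open S"
    and ae: "AE x in lborel. conv_fun_measure (indicator S) \<nu> x = indicator (- S) x"
    and t: "emeasure \<nu> {t} \<noteq> 0"
  shows "x \<in> S \<Longrightarrow> x - t \<notin> S"
proof
  assume x: "x \<in> S" "x - t \<in> S"
  \<comment> \<open>The overlap is open and nonempty, so it contains a good point \<open>z\<close>.
    There the convolution is 0, yet it is at least the mass of the atom \<open>t\<close>.\<close>
  have "open (S \<inter> (\<lambda>x. x - t) -` S)"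
    using S by (intro open_Int open_vimage continuous_intros)
  then obtain z where "z \<in> S \<inter> (\<lambda>x. x - t) -` S"
      "conv_fun_measure (indicator S) \<nu> z = indicator (- S) z"
    using AE_lborel_open_ex[OF ae] x by blast
  then show False
    using conv_indicator_ge_atom[OF \<nu> S, of z t] t by simp
qed

lemma at_right_notin_interval_Union:
  fixes s :: real
  assumes "finite I" "s \<notin> (\<Union>i\<in>I. {a i<..<b i})" "\<And>i. i \<in> I \<Longrightarrow> s \<noteq> a i"
  shows "\<forall>\<^sub>F x in at_right s. x \<notin> (\<Union>i\<in>I. {a i<..<b i})"
proof -
  have "\<forall>\<^sub>F x in at_right s. x \<notin> {a i<..<b i}" if "i \<in> I" for i
  proof (cases "s < a i")
    case True
    then show ?thesis
      unfolding eventually_at_right_field by (intro exI[of _ "a i"]) auto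
  next
    case False
    then have "b i \<le> s"
      using assms(2,3) that by force
    then show ?thesis
      unfolding eventually_at_right_field by (intro exI[of _ "s + 1"]) auto
  qed
  then have "\<forall>\<^sub>F x in at_right s. \<forall>i\<in>I. x \<notin> {a i<..<b i}"
    using assms(1) by (simp add: eventually_ball_finite)
  then show ?thesis
    by (auto elim: eventually_mono)
qed

text \<open>An interval of the tiling ends at \<open>y\<close>: either the component of \<open>\<Omega>\<close> with right endpoint \<open>y\<close>
  or a translated one. The gap to the right of \<open>y\<close> forces another one to start there.\<close>

lemma weak_tiling_next_atom:
  assumes \<Omega>: "\<Omega> = (\<Union>i\<in>I. {a i <..< b i})" and I: "finite I" and j: "j \<in> I"
    and ab: "\<And>i. i \<in> I \<Longrightarrow> a i < b i" and bn: "\<And>i. i \<in> I \<Longrightarrow> b i \<notin> \<Omega>"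
    and \<nu>: "sets \<nu> = sets borel" "locally_finite_measure \<nu>"
    and ae: "AE x in lborel. conv_fun_measure (indicator \<Omega>) \<nu> x = indicator (- \<Omega>) x"
    and gap: "\<forall>\<^sub>F x in at_right y. x \<notin> \<Omega>"
    and y: "y = b j \<or> emeasure \<nu> {y - b j} \<noteq> 0 \<and> (\<forall>\<^sub>F x in at_left y. x \<notin> \<Omega>)"
  shows "\<exists>i\<in>I. emeasure \<nu> {y - a i} \<noteq> 0"
proof (rule ccontr)
  assume "\<not> ?thesis"
  then have na: "emeasure \<nu> {y - a i} = 0" if "i \<in> I" for i
    using that by auto
  have op: "open \<Omega>" and bd: "bounded \<Omega>"
    using I unfolding \<Omega> by auto
  have left: "\<forall>\<^sub>F x in at_left (b j). x \<in> \<Omega>"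
    unfolding eventually_at_left_field \<Omega> using ab j by (intro exI[of _ "a j"]) auto
  have "AE t in \<nu>. \<forall>i\<in>I. t \<noteq> y - a i"
    using I
  proof (rule AE_finite_allI)
    fix i assume "i \<in> I"
    then show "AE t in \<nu>. t \<noteq> y - a i"
      using na \<nu>(1) by (intro AE_I[of _ _ "{y - a i}"]) auto
  qed
  then have nc: "AE t in \<nu>. y - t \<notin> \<Omega> \<longrightarrow> (\<forall>\<^sub>F s in at_right (y - t). s \<notin> \<Omega>)"
  proof eventually_elim
    case (elim t)
    then show ?case
      unfolding \<Omega> by (intro impI at_right_notin_interval_Union I) (auto simp: algebra_simps)
  qed
  \<comment> \<open>Without an atom causing an upward jump at \<open>y\<close>, the value 1 just to
    the right of \<open>y\<close> is already attained at \<open>y\<close>.\<close>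
  have one: "conv_fun_measure (indicator \<Omega>) \<nu> y = 1"
    using gap by (intro conv_indicator_right_limit[OF \<nu> op bd ae _ nc]) (auto elim: eventually_mono)
  show False
    using y
  proof (elim disjE conjE)
    \<comment> \<open>Here \<Omega> fills the left side of \<open>y\<close>, so the left limit is 0,
      below the value 1 at \<open>y\<close>.\<close>
    assume "y = b j"
    with left have "\<forall>\<^sub>F x in at_left y. indicator (- \<Omega>) x = (0 :: ennreal)"
      by (auto elim: eventually_mono)
    from conv_indicator_left_limit[OF \<nu>(1) op ae this bn[OF j] left] one show False
      by simp
  next
    \<comment> \<open>Here the left limit is 1, but it would have to exceed the value 1 at
      \<open>y\<close> by the mass of the atom.\<close>
    assume at: "emeasure \<nu> {y - b j} \<noteq> 0" and "\<forall>\<^sub>F x in at_left y. x \<notin> \<Omega>"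
    then have "\<forall>\<^sub>F x in at_left y. indicator (- \<Omega>) x = (1 :: ennreal)"
      by (auto elim: eventually_mono)
    from conv_indicator_left_limit[OF \<nu>(1) op ae this bn[OF j] left]
    have "1 + emeasure \<nu> {y - b j} \<le> 1 + 0"
      unfolding one by simp
    with at show False
      by (subst (asm) ennreal_add_left_cancel_le) auto
  qed
qed

text \<open>The gap is described by its two ends alone, so the walk uses no ordering of the
  intervals. The coefficient \<open>p i\<close> counts the translates of interval \<open>i\<close>
  that are laid.\<close>

lemma weak_tiling_gap_length:
  fixes I :: "'i set"
  assumes \<Omega>: "\<Omega> = (\<Union>i\<in>I. {a i <..< b i})" and I: "finite I"
    and ab: "\<And>i. i \<in> I \<Longrightarrow> a i < b i" and bn: "\<And>i. i \<in> I \<Longrightarrow> b i \<notin> \<Omega>"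
    and kl: "k \<in> I" "l \<in> I" "b k \<le> a l" and gap: "\<Omega> \<inter> {b k<..<a l} = {}"
    and tile: "weakly_tiles_complement \<Omega>"
  shows "\<exists>p :: 'i \<Rightarrow> nat. a l - b k = (\<Sum>i\<in>I. real (p i) * (b i - a i))"
proof -
  obtain \<nu> where \<nu>: "sets \<nu> = sets borel" "locally_finite_measure \<nu>"
    and ae: "AE x in lborel. conv_fun_measure (indicator \<Omega>) \<nu> x = indicator (- \<Omega>) x"
    using tile unfolding weakly_tiles_complement_def by blast
  have op: "open \<Omega>"
    unfolding \<Omega> by auto
  \<comment> \<open>The shortest length: every translate reduces the remaining distance by at least
    this much.\<close>
  define \<delta> where "\<delta> = Min ((\<lambda>i. b i - a i) ` I)"
  have "I \<noteq> {}"
    using kl(1) by blast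
  then have \<delta>: "0 < \<delta>" "\<And>i. i \<in> I \<Longrightarrow> \<delta> \<le> b i - a i"
    unfolding \<delta>_def using I kl(1) ab by (auto simp: Min_gr_iff)
  \<comment> \<open>Invariant of the walk: \<open>y\<close> is its start or the right end of a
    translate given by an atom. The number \<open>m\<close> bounds the remaining steps; for
    \<open>m = 0\<close> the premises contradict \<open>y \<le> a l\<close>.\<close>
  have "\<exists>p :: 'i \<Rightarrow> nat. a l - y = (\<Sum>i\<in>I. real (p i) * (b i - a i))"
    if "b k \<le> y" "y \<le> a l" "y = b k \<or> (\<exists>j\<in>I. emeasure \<nu> {y - b j} \<noteq> 0)" "a l - y < real m * \<delta>"
    for y m
    using that
  proof (induction m arbitrary: y)
    case 0
    then show ?case by simp
  next
    case (Suc m)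
    show ?case
    proof (cases "y = a l")
      case True
      then show ?thesis
        by (intro exI[of _ "\<lambda>_. 0"]) simp
    next
      case False
      then have y: "b k \<le> y" "y < a l"
        using Suc.prems by auto
      have right: "\<forall>\<^sub>F x in at_right y. x \<notin> \<Omega>"
        unfolding eventually_at_right_field using y gap by (intro exI[of _ "a l"]) force
      \<comment> \<open>Interval \<open>k\<close> lies directly to the left of \<open>b k\<close>,
        so at the start the alternative \<open>y = b j\<close> with \<open>j = k\<close> is used
        instead.\<close>
      have left: "\<forall>\<^sub>F x in at_left y. x \<notin> \<Omega>" if "y \<noteq> b k"
        unfolding eventually_at_left_field using y gap that by (intro exI[of _ "b k"]) force
      have "\<exists>j\<in>I. y = b j \<or> emeasure \<nu> {y - b j} \<noteq> 0 \<and> (\<forall>\<^sub>F x in at_left y. x \<notin> \<Omega>)"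
        using Suc.prems(3) kl(1) left by blast
      then obtain i where i: "i \<in> I" "emeasure \<nu> {y - a i} \<noteq> 0"
        using weak_tiling_next_atom[OF \<Omega> I _ ab bn \<nu> ae right] by blast
      define z where "z = y + (b i - a i)"
      have "z \<le> a l"
      proof (rule ccontr)
        \<comment> \<open>A translate that overshoots would share points just right of
          \<open>a l\<close> with interval \<open>l\<close>.\<close>
        assume "\<not> z \<le> a l"
        then have "a l < min z (b l)"
          using ab[OF kl(2)] by simp
        then obtain x where x: "a l < x" "x < min z (b l)"
          using dense by blast
        have "x \<in> {a l<..<b l}" "x - (y - a i) \<in> {a i<..<b i}"
          using x y by (auto simp: z_def)
        then have "x \<in> \<Omega>" "x - (y - a i) \<in> \<Omega>"
          unfolding \<Omega> using kl(2) i(1) by blast+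
        then show False
          using weak_tiling_atom_disjoint[OF \<nu>(1) op ae i(2)] by blast
      qed
      moreover have "b k \<le> z"
        using y ab[OF i(1)] by (simp add: z_def)
      moreover have "emeasure \<nu> {z - b i} \<noteq> 0"
        using i(2) by (simp add: z_def algebra_simps)
      moreover have "a l - z < real m * \<delta>"
        using Suc.prems(4) \<delta>(2)[OF i(1)] by (simp add: z_def algebra_simps)
      ultimately obtain p :: "'i \<Rightarrow> nat" where p: "a l - z = (\<Sum>i\<in>I. real (p i) * (b i - a i))"
        using Suc.IH[of z] i(1) by blast
      \<comment> \<open>The translate from \<open>y\<close> to \<open>z\<close> adds one to the
        count at \<open>i\<close>.\<close>
      have "(\<Sum>h\<in>I. real ((p(i := Suc (p i))) h) * (b h - a h))
          = (\<Sum>h\<in>I. real (p h) * (b h - a h) + (if h = i then b i - a i else 0))"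
        by (intro sum.cong) (auto simp: algebra_simps)
      also have "\<dots> = a l - y"
        using I i(1) by (simp add: sum.distrib p[symmetric] z_def)
      finally show ?thesis
        by metis
    qed
  qed
  moreover obtain m :: nat where "a l - b k < real m * \<delta>"
    using reals_Archimedean3[OF \<delta>(1)] by blast
  ultimately show ?thesis
    using kl(3) by blast
qed

section \<open>Intervals listed from left to right\<close>

theorem theorem3p6:
  fixes n :: nat and a b :: "nat \<Rightarrow> real" and \<Omega> :: "real set"
  assumes \<Omega>: "\<Omega> = (\<Union>i\<in>{1..n}. {a i <..< b i})"
    and "\<And>i. 1 \<le> i \<Longrightarrow> i \<le> n \<Longrightarrow> a i < b i"
    and "\<And>i. 1 \<le> i \<Longrightarrow> i < n \<Longrightarrow> b i < a (i + 1)"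
    and "weakly_tiles_complement \<Omega>"
  shows "\<forall>k. 1 \<le> k \<and> k \<le> n - 1 \<longrightarrow>
           (\<exists>p :: nat \<Rightarrow> nat. a (k + 1) - b k = (\<Sum>i=1..n. real (p i) * (b i - a i)))"
proof (intro allI impI)
  fix k assume "1 \<le> k \<and> k \<le> n - 1"
  then have k: "1 \<le> k" "k < n"
    by auto
  note ab = assms(2) and ba = assms(3)
  \<comment> \<open>The hypotheses compare neighbours only. Comparing arbitrary indices keeps right
    endpoints outside \<Omega> and the gap free of other intervals.\<close>
  have order: "b i < a j" if "1 \<le> i" "i < j" "j \<le> n" for i j
    using that(2,3)
  proof (induction j)
    case 0
    then show ?case by simp
  next
    case (Suc j)
    show ?case
    proof (cases "i = j")
      case True
      then show ?thesis
        using ba[of j] that(1) Suc.prems by simp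
    next
      case False
      then have "b i < a j"
        using Suc by simp
      also have "a j < b j"
        using ab[of j] that(1) Suc.prems by simp
      also have "b j < a (Suc j)"
        using ba[of j] that(1) Suc.prems by simp
      finally show ?thesis .
    qed
  qed
  show "\<exists>p :: nat \<Rightarrow> nat. a (k + 1) - b k = (\<Sum>i=1..n. real (p i) * (b i - a i))"
  proof (rule weak_tiling_gap_length[OF \<Omega> _ _ _ _ _ _ _ assms(4)])
    show "b i \<notin> \<Omega>" if "i \<in> {1..n}" for i
    proof
      assume "b i \<in> \<Omega>"
      then obtain j where "1 \<le> j" "j \<le> n" "a j < b i" "b i < b j"
        unfolding \<Omega> by auto
      then show False
        using order[of i j] order[of j i] ab[of i] that by (cases i j rule: linorder_cases) auto
    qed
    show "\<Omega> \<inter> {b k<..<a (k + 1)} = {}"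
    proof (rule ccontr)
      assume "\<not> ?thesis"
      then obtain x j where "1 \<le> j" "j \<le> n" "a j < x" "x < b j" "b k < x" "x < a (k + 1)"
        unfolding \<Omega> by auto
      then show False
        using order[of j k] order[of "k + 1" j] ab[of k] ab[of "k + 1"] k
        by (cases j k rule: linorder_cases; cases "j = k + 1") auto
    qed
  qed (use k ab order[of k "k + 1"] in auto)
qed

end
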